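(* There exists a non-trivial invertible t.d.s. which is topological K and has a unique minimal point.
   Context: $\mathbb{Z}_+=\{0,1,2,\dots\}$, $\mathbb{N}=\{1,2,\dots\}$. A t.d.s. $(X,T)$ is a (nonempty) compact metrizable space $X$ with a surjective continuous map $T:X\to X$; it is invertible if $T$ is a homeomorphism, and non-trivial if $X$ has more than one point. A point $x\in X$ is minimal if its orbit closure $\overline{\{T^nx:n\in\mathbb{Z}_+\}}$ is a minimal system under $T$ (every forward orbit in it is dense in it). A set $F\subseteq\mathbb{Z}_+$ is an independence set for a tuple $(A_1,\dots,A_k)$ of subsets of $X$ if for every nonempty finite $J\subseteq F$ and every $s\in\{1,\dots,k\}^J$ one has $\bigcap_{j\in J}T^{-j}A_{s(j)}\neq\emptyset$. The upper Banach density of $F\subseteq\mathbb{Z}_+$ is $BD^*(F)=\limsup_{|I|\to+\infty}\frac{|F\cap I|}{|I|}$, with $I$ ranging over nonempty finite intervals of $\mathbb{Z}_+$. $(X,T)$ is topological K if for every $k\in\mathbb{N}$ and all nonempty open subsets $U_1,\dots,U_k$ of $X$, the tuple $(U_1,\dots,U_k)$ has an independence set of positive upper Banach density. *)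

theory Defs
  imports "HOL-Analysis.Analysis"
begin

(* A compact metrizable space embeds in the Hilbert cube, so each is homeomorphic to some abstract
   topology on a subset of the type int => real; quantifying existentially over topologies of that
   type therefore covers all such spaces. *)
definition tds :: "'a topology \<Rightarrow> ('a \<Rightarrow> 'a) \<Rightarrow> bool" where
  "tds X T \<longleftrightarrow> topspace X \<noteq> {} \<and> compact_space X \<and> metrizable_space X \<and>
     continuous_map X X T \<and> T ` topspace X = topspace X"

definition invertible_tds :: "'a topology \<Rightarrow> ('a \<Rightarrow> 'a) \<Rightarrow> bool" where
  "invertible_tds X T \<longleftrightarrow> tds X T \<and> homeomorphic_map X X T"

definition nontrivial_space :: "'a topology \<Rightarrow> bool" where
  "nontrivial_space X \<longleftrightarrow> (\<exists>x\<in>topspace X. \<exists>y\<in>topspace X. x \<noteq> y)"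

definition forward_orbit :: "('a \<Rightarrow> 'a) \<Rightarrow> 'a \<Rightarrow> 'a set" where
  "forward_orbit T x = {(T ^^ n) x | n. True}"

definition minimal_system :: "'a topology \<Rightarrow> ('a \<Rightarrow> 'a) \<Rightarrow> bool" where
  "minimal_system X T \<longleftrightarrow> (\<forall>x\<in>topspace X. X closure_of forward_orbit T x = topspace X)"

definition minimal_point :: "'a topology \<Rightarrow> ('a \<Rightarrow> 'a) \<Rightarrow> 'a \<Rightarrow> bool" where
  "minimal_point X T x \<longleftrightarrow> x \<in> topspace X \<and>
     minimal_system (subtopology X (X closure_of forward_orbit T x)) T"

(* A tuple (A_1, ..., A_k) is a function on nat of which only the values at 1, ..., k matter. *)
definition independence_set ::
  "'a topology \<Rightarrow> ('a \<Rightarrow> 'a) \<Rightarrow> nat \<Rightarrow> (nat \<Rightarrow> 'a set) \<Rightarrow> nat set \<Rightarrow> bool" where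
  "independence_set X T k A F \<longleftrightarrow>
     (\<forall>J s. J \<subseteq> F \<and> finite J \<and> J \<noteq> {} \<and> s \<in> J \<rightarrow> {1..k} \<longrightarrow>
        (\<Inter>j\<in>J. {x \<in> topspace X. (T ^^ j) x \<in> A (s j)}) \<noteq> {})"

(* Nonempty finite intervals I of nat, directed by card I tending to infinity. *)
definition long_intervals :: "nat set filter" where
  "long_intervals = inf (filtercomap card at_top) (principal {{a..b} | a b. a \<le> b})"

(* ereal-valued because Limsup needs a complete lattice. *)
definition upper_Banach_density :: "nat set \<Rightarrow> ereal" where
  "upper_Banach_density F =
     Limsup long_intervals (\<lambda>I. ereal (real (card (F \<inter> I)) / real (card I)))"

definition topological_K :: "'a topology \<Rightarrow> ('a \<Rightarrow> 'a) \<Rightarrow> bool" where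
  "topological_K X T \<longleftrightarrow>
     (\<forall>k\<ge>1. \<forall>U. (\<forall>i\<in>{1..k}. openin X (U i) \<and> U i \<noteq> {}) \<longrightarrow>
        (\<exists>F. independence_set X T k U F \<and> upper_Banach_density F > 0))"

end

theory Submission
  imports Defs
begin

text \<open>
  The system is the subshift of all sequences \<open>x \<in> {0, 1}\<^sup>\<int>\<close> such that for every \<open>n\<close> each window
  of length \<open>64^n\<close> contains \<open>n\<close> consecutive zeros. These conditions are closed and shift invariant.

  They leave only one minimal point: the forward orbit of every \<open>x\<close> meets arbitrarily long runs of
  zeros, so its closure contains the fixed point \<open>0\<close>, and a minimal orbit closure containing a fixed
  point is that point (\<open>zero_in_orbit_closure\<close>, \<open>unique_minimal_gap_shift\<close>).

  On the other hand the windows grow so fast that the required runs of zeros cost only a small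
  proportion of the coordinates, which leaves room for independence. Given nonempty open sets
  \<open>U\<^sub>1, \<dots>, U\<^sub>k\<close>, choose \<open>p\<close> such that each \<open>U\<^sub>r\<close> contains a cylinder given by the central block
  of radius \<open>p\<close> of some point of the subshift. Cut this point off on both sides at the far end of a run of
  \<open>p\<close> zeros (\<open>truncate_gap_sequence\<close>). The resulting finite words can be placed, in any order,
  into consecutive slots of length \<open>L = 8 * 64^p\<close> without violating the conditions for \<open>n \<le> p\<close>: a window inside one
  slot sees only one word, and a window crossing a slot boundary sees the zeros around that boundary.
  The conditions for \<open>n > p\<close> are met by leaving some slots empty. For \<open>n = p + 1 + d\<close> it
  suffices to empty the last \<open>d + 1\<close> slots of each period of \<open>4 * 64^d\<close> slots, because
  \<open>(d + 1) * L \<ge> n\<close> and two periods have total length \<open>64^n\<close>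
  (\<open>concatenation_in_gap_sequences\<close>). Since \<open>\<Sum>d. (d + 1) / (4 * 64^d) < 1/2\<close>, at least half of the
  slots in suitable long intervals survive (\<open>card_kept_slots\<close>). The positions of the surviving slots form
  an independence set of upper Banach density at least \<open>1 / (2 * L)\<close>.
\<close>

section \<open>Sequences with syndetic runs of zeros\<close>

definition zeros_syndetic :: "nat \<Rightarrow> nat \<Rightarrow> (int \<Rightarrow> real) \<Rightarrow> bool" where
  "zeros_syndetic n N x \<longleftrightarrow>
     (\<forall>i. \<exists>a. i \<le> a \<and> a + int n \<le> i + int N \<and> (\<forall>j. a \<le> j \<and> j < a + int n \<longrightarrow> x j = 0))"

text \<open>The factor \<open>64\<close> between consecutive window lengths makes room for the independence argument: a
  word cut off with respect to the conditions up to level \<open>p\<close> fits into a slot of length \<open>8 * 64^p\<close>, and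
  a window of level \<open>p + 1\<close> has the length of \<open>8\<close> such slots, at least two of which are left empty.\<close>

definition gap_sequences :: "(int \<Rightarrow> real) set" where
  "gap_sequences = {x. (\<forall>i. x i \<in> {0, 1}) \<and> (\<forall>n. zeros_syndetic n (64 ^ n) x)}"

definition gap_space :: "(int \<Rightarrow> real) topology" where
  "gap_space = subtopology (product_topology (\<lambda>_. euclideanreal) UNIV) gap_sequences"

definition shift :: "(int \<Rightarrow> real) \<Rightarrow> int \<Rightarrow> real" where
  "shift x = (\<lambda>i. x (i + 1))"

lemma double_le_power64: "2 * n \<le> (64::nat) ^ n"
proof (induction n)
  case (Suc n)
  define K where "K = (64::nat) ^ n"
  have "1 \<le> K" "2 * n \<le> K"
    using Suc by (simp_all add: K_def)
  then show ?case unfolding power_Suc K_def[symmetric] by simp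
qed simp

lemma double_le_power64_int: "2 * int n \<le> 64 ^ n"
proof -
  have "int (2 * n) \<le> int (64 ^ n)"
    using double_le_power64[of n] unfolding of_nat_le_iff .
  then show ?thesis by simp
qed

lemma zeros_syndeticD:
  assumes "zeros_syndetic n N x"
  obtains a where "i \<le> a" "a + int n \<le> i + int N" "\<And>j. a \<le> j \<Longrightarrow> j < a + int n \<Longrightarrow> x j = 0"
  using assms unfolding zeros_syndetic_def by blast

lemma zeros_syndetic_translate:
  assumes "zeros_syndetic n N x"
  shows "zeros_syndetic n N (\<lambda>i. x (i + c))"
  unfolding zeros_syndetic_def
proof
  fix i
  obtain a where a: "i + c \<le> a" "a + int n \<le> i + c + int N"
    "\<And>j. a \<le> j \<Longrightarrow> j < a + int n \<Longrightarrow> x j = 0"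
    using zeros_syndeticD[OF assms, of "i + c"] by metis
  show "\<exists>a. i \<le> a \<and> a + int n \<le> i + int N \<and> (\<forall>j. a \<le> j \<and> j < a + int n \<longrightarrow> x (j + c) = 0)"
    using a by (intro exI[of _ "a - c"]) auto
qed

lemma gap_sequences_translate:
  "x \<in> gap_sequences \<Longrightarrow> (\<lambda>i. x (i + c)) \<in> gap_sequences"
  unfolding gap_sequences_def using zeros_syndetic_translate by auto

lemma topspace_gap_space [simp]: "topspace gap_space = gap_sequences"
  by (simp add: gap_space_def)

lemma funpow_shift: "(shift ^^ n) x = (\<lambda>i. x (i + int n))"
  by (induction n arbitrary: x) (auto simp: shift_def algebra_simps)

lemma zero_in_gap_sequences: "(\<lambda>_. 0) \<in> gap_sequences"
proof -
  have "n \<le> (64::nat) ^ n" for n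
    using double_le_power64[of n] by linarith
  then have "int n \<le> int (64 ^ n)" for n
    unfolding of_nat_le_iff .
  then show ?thesis
    unfolding gap_sequences_def zeros_syndetic_def by auto
qed

lemma delta_in_gap_sequences: "(\<lambda>i. if i = 0 then 1 else 0) \<in> gap_sequences"
proof -
  have "zeros_syndetic n (64 ^ n) (\<lambda>i. if i = 0 then 1 else 0)" for n
    unfolding zeros_syndetic_def
  proof
    fix i :: int
    have le: "2 * int n \<le> int (64 ^ n)"
      using double_le_power64[of n] by linarith
    show "\<exists>a. i \<le> a \<and> a + int n \<le> i + int (64 ^ n) \<and>
        (\<forall>j. a \<le> j \<and> j < a + int n \<longrightarrow> (if j = 0 then 1 else 0) = (0::real))"
    proof (cases "i \<le> 0 \<and> 0 < i + int n")
      case True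
      then show ?thesis using le by (intro exI[of _ 1]) auto
    next
      case False
      then show ?thesis using le by (intro exI[of _ i]) auto
    qed
  qed
  then show ?thesis
    unfolding gap_sequences_def by auto
qed

text \<open>Each window leaves finitely many positions for the run of zeros, so the existential quantifier
  is a finite union of closed conditions.\<close>

lemma closedin_gap_sequences:
  "closedin (product_topology (\<lambda>_. euclideanreal) UNIV) gap_sequences"
proof -
  have cont: "continuous_on UNIV (\<lambda>x::int \<Rightarrow> real. x i)" for i
    by (rule continuous_on_product_coordinates)
  have val: "closed {x::int \<Rightarrow> real. x i = c}" for i c
    by (intro closed_Collect_eq cont continuous_on_const)
  have bin: "closed {x::int \<Rightarrow> real. x i \<in> {0, 1}}" for i
    using closed_Un[OF val[of i 0] val[of i 1]] by (simp add: Collect_disj_eq)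
  have run: "closed {x::int \<Rightarrow> real. \<forall>j. a \<le> j \<and> j < a + int n \<longrightarrow> x j = 0}" for a n
    by (intro closed_Collect_all closed_Collect_imp val) auto
  have win: "closed {x::int \<Rightarrow> real. \<exists>a. i \<le> a \<and> a + int n \<le> i + int N \<and>
      (\<forall>j. a \<le> j \<and> j < a + int n \<longrightarrow> x j = 0)}" for i n N
  proof -
    have "{x::int \<Rightarrow> real. \<exists>a. i \<le> a \<and> a + int n \<le> i + int N \<and>
        (\<forall>j. a \<le> j \<and> j < a + int n \<longrightarrow> x j = 0)} =
      (\<Union>a\<in>{i..i + int N - int n}. {x. \<forall>j. a \<le> j \<and> j < a + int n \<longrightarrow> x j = 0})"
      by (auto simp: algebra_simps; force simp: algebra_simps)
    then show ?thesis
      using run by (auto intro!: closed_UN)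
  qed
  have "closed gap_sequences"
    unfolding gap_sequences_def zeros_syndetic_def
    by (intro closed_Collect_conj closed_Collect_all bin win)
  then show ?thesis
    by (simp add: euclidean_product_topology)
qed

lemma compact_gap_space: "compact_space gap_space"
proof -
  have "compactin (product_topology (\<lambda>_::int. euclideanreal) UNIV) (PiE UNIV (\<lambda>_. {0, 1}))"
    unfolding compactin_PiE by (simp add: finite_imp_compact)
  moreover have "gap_sequences \<subseteq> PiE UNIV (\<lambda>_. {0, 1})"
    unfolding gap_sequences_def by (auto simp: PiE_def)
  ultimately have "compactin (product_topology (\<lambda>_. euclideanreal) UNIV) gap_sequences"
    using closed_compactin closedin_gap_sequences by metis
  then show ?thesis
    by (simp add: gap_space_def compact_space_subtopology)
qed

lemma metrizable_gap_space: "metrizable_space gap_space"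
  unfolding gap_space_def
  by (intro metrizable_space_subtopology)
    (simp add: metrizable_space_product_topology metrizable_space_euclidean)

lemma continuous_map_translate: "continuous_map gap_space gap_space (\<lambda>x i. x (i + c))"
proof -
  let ?P = "product_topology (\<lambda>_::int. euclideanreal) UNIV"
  have "continuous_map gap_space ?P (\<lambda>x i. x (i + c))"
    unfolding continuous_map_componentwise_UNIV gap_space_def
    by (intro allI continuous_map_from_subtopology continuous_map_product_projection) auto
  then have "continuous_map gap_space (subtopology ?P gap_sequences) (\<lambda>x i. x (i + c))"
    unfolding continuous_map_in_subtopology using gap_sequences_translate by auto
  then show ?thesis
    by (simp add: gap_space_def)
qed

lemma invertible_gap_shift: "invertible_tds gap_space shift"
proof -
  have T: "shift = (\<lambda>x i. x (i + 1))"
    by (auto simp: shift_def)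
  have "homeomorphic_maps gap_space gap_space (\<lambda>x i. x (i + 1)) (\<lambda>x i. x (i + (-1)))"
    unfolding homeomorphic_maps_def
    using continuous_map_translate[of 1] continuous_map_translate[of "-1"] by simp
  then have hom: "homeomorphic_map gap_space gap_space shift"
    unfolding T homeomorphic_map_maps by blast
  moreover have "shift ` gap_sequences = gap_sequences"
    using homeomorphic_imp_surjective_map[OF hom] by simp
  ultimately show ?thesis
    unfolding invertible_tds_def tds_def
    using compact_gap_space metrizable_gap_space zero_in_gap_sequences homeomorphic_imp_continuous_map
    by auto
qed

lemma openin_gap_space_cylinder:
  assumes U: "openin gap_space U" and x: "x \<in> U"
  obtains m :: nat where "\<And>y. y \<in> gap_sequences \<Longrightarrow> (\<And>i. \<bar>i\<bar> \<le> int m \<Longrightarrow> y i = x i) \<Longrightarrow> y \<in> U"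
proof -
  obtain V where V: "openin (product_topology (\<lambda>_::int. euclideanreal) UNIV) V" "U = V \<inter> gap_sequences"
    using U unfolding gap_space_def openin_subtopology by blast
  then obtain B where B: "finite {i::int. B i \<noteq> (UNIV::real set)}"
    "x \<in> PiE UNIV B" "PiE UNIV B \<subseteq> V"
    using x unfolding openin_product_topology_alt by fastforce
  define m where "m = Max (insert 0 ((\<lambda>i. nat \<bar>i\<bar>) ` {i. B i \<noteq> UNIV}))"
  have m: "\<bar>i\<bar> \<le> int m" if "B i \<noteq> UNIV" for i
  proof -
    have "nat \<bar>i\<bar> \<le> m"
      unfolding m_def using B(1) that by (intro Max_ge) auto
    then show ?thesis by simp
  qed
  show thesis
  proof
    fix y assume y: "y \<in> gap_sequences" "\<And>i. \<bar>i\<bar> \<le> int m \<Longrightarrow> y i = x i"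
    have "y i \<in> B i" for i
      using B(2) m[of i] y(2)[of i] by (cases "B i = UNIV") (auto simp: PiE_def Pi_def)
    then show "y \<in> U"
      using B(3) V(2) y(1) by (auto simp: PiE_def)
  qed
qed

section \<open>The unique minimal point\<close>

lemma zero_in_orbit_closure:
  assumes x: "x \<in> gap_sequences"
  shows "(\<lambda>_. 0) \<in> gap_space closure_of forward_orbit shift x"
  unfolding in_closure_of
proof (intro conjI allI impI)
  show "(\<lambda>_. 0) \<in> topspace gap_space"
    using zero_in_gap_sequences by simp
next
  fix U assume "(\<lambda>_. 0) \<in> U \<and> openin gap_space U"
  then obtain m :: nat where m: "\<And>y. y \<in> gap_sequences \<Longrightarrow> (\<And>i. \<bar>i\<bar> \<le> int m \<Longrightarrow> y i = 0) \<Longrightarrow> y \<in> U"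
    using openin_gap_space_cylinder by metis
  have "zeros_syndetic (2 * m + 1) (64 ^ (2 * m + 1)) x"
    using x unfolding gap_sequences_def by blast
  then obtain a where a: "0 \<le> a" "\<And>j. a \<le> j \<Longrightarrow> j < a + int (2 * m + 1) \<Longrightarrow> x j = 0"
    using zeros_syndeticD by metis
  have "(shift ^^ (nat a + m)) x \<in> U"
  proof (rule m)
    show "(shift ^^ (nat a + m)) x \<in> gap_sequences"
      unfolding funpow_shift by (rule gap_sequences_translate[OF x])
  qed (use a in \<open>auto simp: funpow_shift\<close>)
  then show "\<exists>y. y \<in> forward_orbit shift x \<and> y \<in> U"
    unfolding forward_orbit_def by auto
qed

lemma unique_minimal_gap_shift: "\<exists>!x. minimal_point gap_space shift x"
proof -
  let ?z = "\<lambda>_::int. 0::real"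
  have orb: "forward_orbit shift ?z = {?z}"
    unfolding forward_orbit_def funpow_shift by auto
  have "Hausdorff_space gap_space"
    using metrizable_gap_space metrizable_imp_Hausdorff_space by blast
  then have cl: "gap_space closure_of {?z} = {?z}"
    using zero_in_gap_sequences by (simp add: closure_of_closedin closedin_Hausdorff_sing_eq)
  show ?thesis
  proof
    show "minimal_point gap_space shift ?z"
      unfolding minimal_point_def minimal_system_def
      using zero_in_gap_sequences by (simp add: orb cl closure_of_subtopology)
  next
    fix x assume min: "minimal_point gap_space shift x"
    let ?O = "gap_space closure_of forward_orbit shift x"
    have x: "x \<in> gap_sequences"
      using min unfolding minimal_point_def by simp
    have sub: "?O \<subseteq> gap_sequences"
      using closure_of_subset_topspace[of gap_space] by simp
    have "forward_orbit shift x \<subseteq> gap_sequences"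
      unfolding forward_orbit_def funpow_shift using gap_sequences_translate[OF x] by auto
    then have "forward_orbit shift x \<subseteq> ?O"
      by (intro closure_of_subset) simp
    moreover have "x \<in> forward_orbit shift x"
      unfolding forward_orbit_def by (auto intro: exI[of _ 0])
    ultimately have "x \<in> ?O" by blast
    moreover have "subtopology gap_space ?O closure_of {?z} = ?O"
      using min zero_in_orbit_closure[OF x] sub zero_in_gap_sequences
      unfolding minimal_point_def minimal_system_def by (auto simp: orb Int_absorb1)
    ultimately have "x \<in> gap_space closure_of {?z}"
      using closure_of_subtopology_subset by fastforce
    then show "x = ?z"
      using cl by simp
  qed
qed

section \<open>A set of slots of positive density with long periodic gaps\<close>

text \<open>The gaps are placed at the end of each period. At the beginning of the periods, the gaps of all
  levels \<open>d\<close> would overlap at \<open>0\<close> and remove every natural number; at the end, the gaps of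
  level \<open>d > D\<close> lie beyond \<open>4 * 64^D\<close>.\<close>

definition kept_slots :: "int set" where
  "kept_slots = {t. 0 \<le> t \<and> (\<forall>d::nat. t mod (4 * 64 ^ d) < 4 * 64 ^ d - (int d + 1))}"

text \<open>The slack \<open>D + 1\<close> strengthens the induction hypothesis; multiplied by \<open>64\<close> it pays for the new
  summand \<open>D + 2\<close>.\<close>

lemma sum_discarded_le: "(\<Sum>d\<le>D. (d + 1) * 64 ^ (D - d)) + D + 1 \<le> 2 * (64::nat) ^ D"
proof (induction D)
  case (Suc D)
  have "(\<Sum>d\<le>D. (d + 1) * (64::nat) ^ (Suc D - d)) = 64 * (\<Sum>d\<le>D. (d + 1) * 64 ^ (D - d))"
    unfolding sum_distrib_left by (intro sum.cong) (auto simp: Suc_diff_le)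
  then show ?case
    using Suc by simp
qed simp

text \<open>A union bound: an interval of \<open>4 * 64^D\<close> slots consists of \<open>64^(D - d)\<close> periods of level \<open>d \<le> D\<close>, each
  of which loses \<open>d + 1\<close> slots, and levels above \<open>D\<close> do not reach into it.\<close>

lemma card_kept_slots:
  "2 * 64 ^ D \<le> card (kept_slots \<inter> {0..<4 * 64 ^ D})"
proof -
  define I where "I = {0..<4 * (64::int) ^ D}"
  define B where "B d = {t \<in> I. 4 * 64 ^ d - (int d + 1) \<le> t mod (4 * 64 ^ d)}" for d :: nat
  have cardB: "card (B d) \<le> (d + 1) * 64 ^ (D - d)" if "d \<le> D" for d
  proof -
    define Q where "Q = 4 * (64::int) ^ d"
    have Q: "0 < Q" "4 * (64::int) ^ D = Q * 64 ^ (D - d)"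
      using that by (auto simp: Q_def power_add[symmetric])
    have "B d \<subseteq> (\<lambda>(r, q). (q + 1) * Q - r) ` ({1..int d + 1} \<times> {0..<64 ^ (D - d)})"
    proof
      fix t assume t: "t \<in> B d"
      have "(t div Q) * Q \<le> t"
        using div_mult_mod_eq[of t Q] pos_mod_sign[OF Q(1), of t] by linarith
      moreover have "t < 64 ^ (D - d) * Q"
        using t Q(2) by (simp add: B_def I_def mult.commute)
      ultimately have "(t div Q) * Q < 64 ^ (D - d) * Q"
        by linarith
      then have "t div Q < 64 ^ (D - d)"
        using Q(1) by (simp add: mult_less_cancel_right)
      moreover have "0 \<le> t div Q"
        using t Q(1) by (simp add: B_def I_def pos_imp_zdiv_nonneg_iff)
      moreover have "t mod Q < Q" "Q - (int d + 1) \<le> t mod Q"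
        using t Q by (auto simp: B_def Q_def)
      moreover have "t = (t div Q + 1) * Q - (Q - t mod Q)"
        using div_mult_mod_eq[of t Q] by (simp add: algebra_simps)
      ultimately show "t \<in> (\<lambda>(r, q). (q + 1) * Q - r) ` ({1..int d + 1} \<times> {0..<64 ^ (D - d)})"
        by (intro image_eqI[where x = "(Q - t mod Q, t div Q)"]) auto
    qed
    then have "card (B d) \<le> card ({1..int d + 1} \<times> {0..<(64::int) ^ (D - d)})"
      by (intro surj_card_le) auto
    also have "\<dots> = (d + 1) * 64 ^ (D - d)"
      by (simp add: card_cartesian_product nat_power_eq nat_add_distrib)
    finally show ?thesis .
  qed
  have "I \<subseteq> (kept_slots \<inter> I) \<union> (\<Union>d\<le>D. B d)"
  proof
    fix t assume t: "t \<in> I"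
    show "t \<in> (kept_slots \<inter> I) \<union> (\<Union>d\<le>D. B d)"
    proof (cases "t \<in> kept_slots")
      case False
      then obtain d :: nat where d: "4 * 64 ^ d - (int d + 1) \<le> t mod (4 * 64 ^ d)"
        using t by (auto simp: kept_slots_def I_def not_less)
      have "d \<le> D"
      proof (rule ccontr)
        assume "\<not> d \<le> D"
        then obtain e where e: "d = Suc e" "D \<le> e"
          by (cases d) auto
        define K where "K = (64::int) ^ e"
        have "(64::int) ^ D \<le> K"
          unfolding K_def using e by (intro power_increasing) auto
        moreover have "2 * int e \<le> K"
          using double_le_power64_int[of e] by (simp add: K_def)
        moreover have "1 \<le> K"
          by (simp add: K_def)
        ultimately have "4 * (64 * K) - (int d + 1) \<ge> 4 * (64::int) ^ D"
          unfolding e(1) of_nat_Suc by linarith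
        then have "4 * 64 ^ d - (int d + 1) \<ge> 4 * (64::int) ^ D"
          by (simp add: e(1) K_def)
        moreover have "t mod (4 * 64 ^ d) \<le> t"
          using t by (intro zmod_le_nonneg_dividend) (auto simp: I_def)
        ultimately show False
          using d t by (auto simp: I_def)
      qed
      then show ?thesis
        using d t by (auto simp: B_def)
    qed (use t in auto)
  qed
  moreover have finI: "finite I" by (simp add: I_def)
  moreover have "finite (B d)" for d
    using finI by (simp add: B_def)
  ultimately have "card I \<le> card ((kept_slots \<inter> I) \<union> (\<Union>d\<le>D. B d))"
    by (intro card_mono) auto
  also have "\<dots> \<le> card (kept_slots \<inter> I) + card (\<Union>d\<le>D. B d)"
    by (rule card_Un_le)
  also have "card (\<Union>d\<le>D. B d) \<le> (\<Sum>d\<le>D. card (B d))"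
    by (intro card_UN_le) auto
  also have "\<dots> \<le> (\<Sum>d\<le>D. (d + 1) * 64 ^ (D - d))"
    using cardB by (intro sum_mono) auto
  also have "\<dots> \<le> 2 * 64 ^ D"
    using sum_discarded_le[of D] by linarith
  finally have "card I \<le> card (kept_slots \<inter> I) + 2 * 64 ^ D"
    by simp
  moreover have "card I = 4 * 64 ^ D"
    by (simp add: I_def nat_mult_distrib nat_power_eq)
  ultimately show ?thesis
    by (simp add: I_def)
qed

lemma upper_Banach_density_ge:
  assumes "\<And>K. \<exists>a b. a \<le> b \<and> K \<le> card {a..b} \<and> c * real (card {a..b}) \<le> real (card (F \<inter> {a..b}))"
  shows "ereal c \<le> upper_Banach_density F"
proof (rule ccontr)
  assume "\<not> ereal c \<le> upper_Banach_density F"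
  then have "\<forall>\<^sub>F I in long_intervals. ereal (real (card (F \<inter> I)) / real (card I)) < ereal c"
    unfolding upper_Banach_density_def not_le by (rule Limsup_lessD)
  then obtain Q where Q: "eventually Q at_top"
    "\<And>I. Q (card I) \<Longrightarrow> I \<in> {{a..b} | a b. a \<le> b} \<Longrightarrow> real (card (F \<inter> I)) / real (card I) < c"
    unfolding long_intervals_def eventually_inf_principal eventually_filtercomap by auto
  then obtain K where K: "\<And>n. K \<le> n \<Longrightarrow> Q n"
    unfolding eventually_at_top_linorder by blast
  obtain a b where ab: "a \<le> b" "K \<le> card {a..b}"
    "c * real (card {a..b}) \<le> real (card (F \<inter> {a..b}))"
    using assms by blast
  have "real (card (F \<inter> {a..b})) / real (card {a..b}) < c"
    by (rule Q(2)[OF K]) (use ab in blast)+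
  then show False
    using ab by (simp add: pos_divide_less_eq)
qed

text \<open>The position at which the word in a kept slot is centred, for slots of length \<open>L\<close> and
  words centred at distance \<open>c\<close> from the left end of their slot.\<close>

definition slot_times :: "nat \<Rightarrow> nat \<Rightarrow> nat set" where
  "slot_times L c = {j. \<exists>t\<in>kept_slots. int j = int L * t + int c}"

lemma slot_times_density:
  assumes "c < L"
  shows "upper_Banach_density (slot_times L c) > 0"
proof -
  have "ereal (1 / (2 * real L)) \<le> upper_Banach_density (slot_times L c)"
  proof (rule upper_Banach_density_ge)
    fix K :: nat
    define M where "M = 4 * (64::nat) ^ K"
    have LM: "0 < L * M" using assms by (simp add: M_def)
    have card: "card {0..L * M - 1} = L * M" using LM by simp
    have "K \<le> M" using double_le_power64[of K] by (simp add: M_def)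
    also have "M \<le> L * M" using assms by simp
    finally have "K \<le> card {0..L * M - 1}" by (simp only: card)
    moreover have "M \<le> 2 * card (slot_times L c \<inter> {0..L * M - 1})"
    proof -
      define f where "f t = nat (int L * t + int c)" for t
      let ?A = "kept_slots \<inter> {0..<4 * 64 ^ K}"
      have "inj_on f ?A"
        using assms by (auto simp: inj_on_def f_def kept_slots_def nat_eq_iff)
      moreover have "f ` ?A \<subseteq> slot_times L c \<inter> {0..L * M - 1}"
      proof
        fix j assume "j \<in> f ` ?A"
        then obtain t where t: "t \<in> kept_slots" "0 \<le> t" "t < int M" "j = f t"
          by (auto simp: M_def)
        have j: "int j = int L * t + int c"
          using t by (simp add: f_def)
        have "int L * (t + 1) \<le> int L * int M"
          using t by (intro mult_left_mono) auto
        then have "int j < int (L * M)"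
          using j assms by (simp add: algebra_simps)
        then have "j \<le> L * M - 1"
          unfolding of_nat_less_iff by linarith
        then show "j \<in> slot_times L c \<inter> {0..L * M - 1}"
          using t(1) j unfolding slot_times_def by auto
      qed
      ultimately have "card ?A \<le> card (slot_times L c \<inter> {0..L * M - 1})"
        by (intro card_inj_on_le) auto
      then show ?thesis
        using card_kept_slots[of K] by (simp add: M_def)
    qed
    then have "1 / (2 * real L) * real (card {0..L * M - 1})
        \<le> real (card (slot_times L c \<inter> {0..L * M - 1}))"
      unfolding card using assms by (simp add: field_simps)
    ultimately show "\<exists>a b. a \<le> b \<and> K \<le> card {a..b} \<and>
      1 / (2 * real L) * real (card {a..b}) \<le> real (card (slot_times L c \<inter> {a..b}))"
      by blast
  qed
  moreover have "ereal 0 < ereal (1 / (2 * real L))"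
    using assms by simp
  ultimately show ?thesis
    by (metis less_le_trans zero_ereal_def)
qed

section \<open>Independence\<close>

text \<open>Setting a sequence to zero outside an interval can destroy runs of zeros in windows that meet an
  end of the interval. Cutting at the outer side of two runs of \<open>p\<close> zeros avoids this for \<open>n \<le> p\<close>: a window
  that leaves the interval then has \<open>n\<close> zeros at its own left or right end.\<close>

lemma truncate_gap_sequence:
  assumes x: "x \<in> gap_sequences"
  obtains z where "\<And>i. z i \<in> {0, 1}" "\<And>n. n \<le> p \<Longrightarrow> zeros_syndetic n (64 ^ n) z"
    "\<And>i. \<bar>i\<bar> \<le> int m \<Longrightarrow> z i = x i"
    "\<And>i. z i \<noteq> 0 \<Longrightarrow> \<bar>i\<bar> \<le> int m + 64 ^ p"
proof -
  have sx: "zeros_syndetic n (64 ^ n) x" and vx: "x i \<in> {0, 1}" for n i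
    using x unfolding gap_sequences_def by blast+
  obtain a where a: "- int m - 64 ^ p \<le> a" "a + int p \<le> - int m"
    "\<And>j. a \<le> j \<Longrightarrow> j < a + int p \<Longrightarrow> x j = 0"
    using zeros_syndeticD[OF sx[of p], of "- int m - 64 ^ p"]
    by (metis diff_add_cancel of_nat_numeral of_nat_power)
  obtain b where b: "int m + 1 \<le> b" "b + int p \<le> int m + 1 + 64 ^ p"
    "\<And>j. b \<le> j \<Longrightarrow> j < b + int p \<Longrightarrow> x j = 0"
    using zeros_syndeticD[OF sx[of p], of "int m + 1"] by (metis of_nat_numeral of_nat_power)
  define z where "z i = (if a \<le> i \<and> i < b + int p then x i else 0)" for i
  have left: "z i = 0" if "i < a + int p" for i
    using that a(3)[of i] by (auto simp: z_def)
  have right: "z i = 0" if "b \<le> i" for i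
    using that b(3)[of i] by (auto simp: z_def)
  show thesis
  proof
    show "z i \<in> {0, 1}" for i
      using vx[of i] by (auto simp: z_def)
    show "z i = x i" if "\<bar>i\<bar> \<le> int m" for i
      using that a b by (auto simp: z_def)
    show "\<bar>i\<bar> \<le> int m + 64 ^ p" if "z i \<noteq> 0" for i
      using that a b left[of i] right[of i] by (auto simp: z_def split: if_splits)
    show "zeros_syndetic n (64 ^ n) z" if n: "n \<le> p" for n
      unfolding zeros_syndetic_def
    proof
      fix i
      have le: "int n \<le> int (64 ^ n)"
        using double_le_power64[of n] by linarith
      consider "i \<le> a" | "b + int p \<le> i + int (64 ^ n)" | "a < i" "i + int (64 ^ n) < b + int p"
        by linarith
      then show "\<exists>a. i \<le> a \<and> a + int n \<le> i + int (64 ^ n) \<and> (\<forall>j. a \<le> j \<and> j < a + int n \<longrightarrow> z j = 0)"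
      proof cases
        case 1
        then show ?thesis
          using le left n by (intro exI[of _ i]) auto
      next
        case 2
        then show ?thesis
          using le right n by (intro exI[of _ "i + int (64 ^ n) - int n"]) auto
      next
        case 3
        obtain e where e: "i \<le> e" "e + int n \<le> i + int (64 ^ n)"
          "\<And>j. e \<le> j \<Longrightarrow> j < e + int n \<Longrightarrow> x j = 0"
          using zeros_syndeticD[OF sx[of n], of i] by metis
        then show ?thesis
          using 3 by (intro exI[of _ e]) (auto simp: z_def)
      qed
    qed
  qed
qed

text \<open>The words \<open>w t\<close> are centred in the middle of their slots. Their support bound leaves
  \<open>64^p \<ge> p\<close> zeros at both ends of every slot, which serve the windows of length \<open>64^n\<close>, \<open>n \<le> p\<close>,
  that cross a slot boundary. The windows with \<open>n > p\<close> contain a full period of level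
  \<open>d = n - p - 1\<close> of the set of kept slots, hence its final gap.\<close>

lemma concatenation_in_gap_sequences:
  fixes w :: "int \<Rightarrow> int \<Rightarrow> real" and p :: nat
  defines "L \<equiv> 8 * 64 ^ p"
  assumes val: "\<And>t i. w t i \<in> {0, 1}"
    and syn: "\<And>t n. n \<le> p \<Longrightarrow> zeros_syndetic n (64 ^ n) (w t)"
    and supp: "\<And>t i. w t i \<noteq> 0 \<Longrightarrow> \<bar>i\<bar> \<le> 2 * 64 ^ p"
  shows "(\<lambda>i. if i div L \<in> kept_slots then w (i div L) (i mod L - 4 * 64 ^ p) else 0) \<in> gap_sequences"
    (is "?y \<in> _")
proof -
  define K where "K = (64::int) ^ p"
  have p64: "2 * int n \<le> 64 ^ n" for n
    by (rule double_le_power64_int)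
  have pK: "2 * int p \<le> K" "0 < K"
    using p64 by (simp_all add: K_def)
  have LK: "L = 8 * K"
    by (simp add: L_def K_def)
  have L: "0 < L" by (simp add: L_def)
  have border: "?y i = 0" if "i mod L < int p \<or> L - int p \<le> i mod L" for i
  proof (rule ccontr)
    assume "?y i \<noteq> 0"
    then have "w (i div L) (i mod L - 4 * 64 ^ p) \<noteq> 0"
      by (auto split: if_splits)
    then have "\<bar>i mod L - 4 * K\<bar> \<le> 2 * K"
      unfolding K_def by (rule supp)
    then show False
      using that pK LK by linarith
  qed
  have "zeros_syndetic n (64 ^ n) ?y" for n
    unfolding zeros_syndetic_def
  proof
    fix i
    show "\<exists>a. i \<le> a \<and> a + int n \<le> i + int (64 ^ n) \<and> (\<forall>j. a \<le> j \<and> j < a + int n \<longrightarrow> ?y j = 0)"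
    proof (cases "n \<le> p")
      case True
      define t where "t = i div L"
      have it: "t * L \<le> i" "i < (t + 1) * L"
        using div_mult_mod_eq[of i L] pos_mod_bound[OF L, of i] pos_mod_sign[OF L, of i]
        unfolding t_def distrib_right mult_1_left by linarith+
      show ?thesis
      proof (cases "i + int (64 ^ n) \<le> (t + 1) * L")
        \<comment> \<open>The window sees a translate of the single word \<open>w t\<close>.\<close>
        case inside: True
        obtain e where e: "i - t * L - 4 * 64 ^ p \<le> e"
          "e + int n \<le> i - t * L - 4 * 64 ^ p + int (64 ^ n)"
          "\<And>j. e \<le> j \<Longrightarrow> j < e + int n \<Longrightarrow> w t j = 0"
          using zeros_syndeticD[OF syn[OF True], of "i - t * L - 4 * 64 ^ p"] by metis
        have "?y j = 0" if j: "e + t * L + 4 * 64 ^ p \<le> j" "j < e + t * L + 4 * 64 ^ p + int n" for j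
        proof -
          have "t * L \<le> j" "j < (t + 1) * L"
            using j e it inside by linarith+
          then have "0 \<le> j - t * L" "j - t * L < L"
            unfolding distrib_right mult_1_left by linarith+
          then have "j div L = t" "j mod L = j - t * L"
            by (intro int_div_pos_eq[of j L t "j - t * L"] int_mod_pos_eq[of j L t]; simp)+
          moreover have "w t (j - t * L - 4 * 64 ^ p) = 0"
            using j by (intro e(3)) linarith+
          ultimately show ?thesis by simp
        qed
        moreover have "i \<le> e + t * L + 4 * 64 ^ p"
          "e + t * L + 4 * 64 ^ p + int n \<le> i + int (64 ^ n)"
          using e(1,2) by linarith+
        ultimately show ?thesis by blast
      next
        case False
        \<comment> \<open>The window contains both sides of the boundary \<open>q\<close>. As it has at least \<open>2 * n\<close> places, it
          contains the \<open>n\<close> zeros before \<open>q\<close> or the \<open>n\<close> zeros after \<open>q\<close>.\<close>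
        define q where "q = (t + 1) * L"
        have q: "q = L * t + L" "q = L * (t + 1)"
          by (simp_all add: q_def algebra_simps)
        have near: "?y j = 0" if j: "q - int p \<le> j" "j < q + int p" for j
        proof (cases "j < q")
          case True
          have "j mod L = j - q + L"
            using True j pK LK q by (intro int_mod_pos_eq[of _ _ t]) linarith+
          then show ?thesis using j by (intro border) linarith
        next
          case False
          have "j mod L = j - q"
            using False j pK LK q by (intro int_mod_pos_eq[of _ _ "t + 1"]) linarith+
          then show ?thesis using j by (intro border) linarith
        qed
        show ?thesis
        proof (cases "i \<le> q - int n")
          case True
          moreover have "q - int n + int n \<le> i + int (64 ^ n)"
            using False by (simp add: q_def)
          moreover have "?y j = 0" if "q - int n \<le> j" "j < q - int n + int n" for j
            using that \<open>n \<le> p\<close> by (intro near) linarith+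
          ultimately show ?thesis by blast
        next
          case False
          have "i \<le> q" using it(2) by (simp add: q_def)
          moreover have "q + int n \<le> i + int (64 ^ n)"
            using False p64[of n] by simp
          moreover have "?y j = 0" if "q \<le> j" "j < q + int n" for j
            using that \<open>n \<le> p\<close> by (intro near) linarith+
          ultimately show ?thesis by blast
        qed
      qed
    next
      case False
      define d where "d = n - p - 1"
      have n: "n = p + 1 + d" using False by (simp add: d_def)
      define Q where "Q = 4 * (64::int) ^ d"
      have Q: "0 < Q" and N: "int (64 ^ n) = 2 * (L * Q)"
        by (auto simp: Q_def L_def n power_add)
      have dQ: "int d + 1 \<le> Q"
      proof -
        define k where "k = (64::int) ^ d"
        have "2 * int d \<le> k" "1 \<le> k"
          using p64 by (simp_all add: k_def)
        then show ?thesis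
          unfolding Q_def k_def[symmetric] by linarith
      qed
      \<comment> \<open>The period of length \<open>L * Q\<close> that ends at \<open>e * (L * Q)\<close> is the first one starting after \<open>i\<close>.\<close>
      define e where "e = i div (L * Q) + 2"
      have LQ: "0 < L * Q" using L Q by simp
      have eb: "i + L * Q < e * (L * Q)" "e * (L * Q) \<le> i + 2 * (L * Q)"
        using div_mult_mod_eq[of i "L * Q"] pos_mod_bound[OF LQ, of i] pos_mod_sign[OF LQ, of i]
        unfolding e_def distrib_right by linarith+
      have "int p + 1 \<le> L"
        using pK LK by linarith
      moreover have "int d * 1 \<le> int d * L"
        using L by (intro mult_left_mono) auto
      ultimately have nL: "int n \<le> (int d + 1) * L"
        by (simp add: n algebra_simps)
      have dLQ: "(int d + 1) * L \<le> L * Q"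
        using dQ L by (simp add: mult.commute)
      have "?y j = 0" if j: "e * (L * Q) - int n \<le> j" "j < e * (L * Q)" for j
      proof -
        have 1: "(e * Q - (int d + 1)) * L \<le> j"
          using j nL by (simp add: algebra_simps)
        have 2: "j < (e * Q) * L"
          using j by (simp add: algebra_simps)
        have lo: "e * Q - (int d + 1) \<le> j div L"
          using zdiv_mono1[OF 1 L] L by simp
        have hi: "j div L < e * Q"
          using 2 L by (smt (verit) div_mult_mod_eq mult_right_mono pos_mod_sign)
        have "(j div L) mod Q = j div L - (e - 1) * Q"
          using lo hi Q dQ by (intro int_mod_pos_eq[of _ _ "e - 1"]) (auto simp: algebra_simps)
        then have "Q - (int d + 1) \<le> (j div L) mod Q"
          using lo by (simp add: algebra_simps)
        then have "j div L \<notin> kept_slots"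
          unfolding kept_slots_def Q_def by (auto simp: not_less)
        then show ?thesis by simp
      qed
      moreover have "i \<le> e * (L * Q) - int n" "e * (L * Q) - int n + int n \<le> i + int (64 ^ n)"
        using eb nL dLQ N by linarith+
      ultimately show ?thesis
        by (intro exI[of _ "e * (L * Q) - int n"]) simp
    qed
  qed
  then show ?thesis
    using val unfolding gap_sequences_def by auto
qed

text \<open>Given a choice \<open>s\<close> of sets, the witness places the word of \<open>U\<^bsub>s j\<^esub>\<close> in the kept slot whose centre is \<open>j\<close>.
  Kept slots whose centre is not in \<open>J\<close> may carry any word, here the first one.\<close>

lemma topological_K_gap_shift: "topological_K gap_space shift"
  unfolding topological_K_def
proof (intro allI impI)
  fix k :: nat and U :: "nat \<Rightarrow> (int \<Rightarrow> real) set"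
  assume k: "1 \<le> k" and U: "\<forall>i\<in>{1..k}. openin gap_space (U i) \<and> U i \<noteq> {}"
  have "\<exists>x m. x \<in> gap_sequences \<and>
      (\<forall>y\<in>gap_sequences. (\<forall>i. \<bar>i\<bar> \<le> int m \<longrightarrow> y i = x i) \<longrightarrow> y \<in> U r)" if r: "r \<in> {1..k}" for r
  proof -
    have op: "openin gap_space (U r)" and "U r \<noteq> {}"
      using U r by auto
    then obtain x where x: "x \<in> U r"
      by blast
    have "x \<in> gap_sequences"
      using openin_subset[OF op] x by auto
    moreover obtain m :: nat where "\<And>y. y \<in> gap_sequences \<Longrightarrow> (\<And>i. \<bar>i\<bar> \<le> int m \<Longrightarrow> y i = x i) \<Longrightarrow> y \<in> U r"
      using openin_gap_space_cylinder[OF op x] by metis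
    ultimately show ?thesis
      by metis
  qed
  then obtain x m where xm: "\<And>r. r \<in> {1..k} \<Longrightarrow> x r \<in> gap_sequences \<and>
      (\<forall>y\<in>gap_sequences. (\<forall>i. \<bar>i\<bar> \<le> int (m r) \<longrightarrow> y i = x r i) \<longrightarrow> y \<in> U r)"
    by metis
  define p where "p = Max (m ` {1..k})"
  have mp: "m r \<le> p" if "r \<in> {1..k}" for r
    unfolding p_def using that by (intro Max_ge) auto
  have "\<exists>z. (\<forall>i. z i \<in> {0, 1}) \<and> (\<forall>n\<le>p. zeros_syndetic n (64 ^ n) z) \<and>
      (\<forall>i. \<bar>i\<bar> \<le> int p \<longrightarrow> z i = x r i) \<and> (\<forall>i. z i \<noteq> 0 \<longrightarrow> \<bar>i\<bar> \<le> int p + 64 ^ p)"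
    if r: "r \<in> {1..k}" for r
    using truncate_gap_sequence[of "x r" p p] xm[OF r] by metis
  then obtain z where z: "\<And>r. r \<in> {1..k} \<Longrightarrow> (\<forall>i. z r i \<in> {0, 1}) \<and>
      (\<forall>n\<le>p. zeros_syndetic n (64 ^ n) (z r)) \<and>
      (\<forall>i. \<bar>i\<bar> \<le> int p \<longrightarrow> z r i = x r i) \<and> (\<forall>i. z r i \<noteq> 0 \<longrightarrow> \<bar>i\<bar> \<le> int p + 64 ^ p)"
    by metis
  define L where "L = 8 * (64::nat) ^ p"
  define c where "c = 4 * (64::nat) ^ p"
  have p64: "2 * int p \<le> 64 ^ p"
    by (rule double_le_power64_int)
  have pc: "int p < int c" "int p + int c < int L"
  proof -
    define K where "K = (64::int) ^ p"
    have "2 * int p \<le> K" "1 \<le> K" "int c = 4 * K" "int L = 8 * K"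
      using p64 by (simp_all add: K_def L_def c_def)
    then show "int p < int c" "int p + int c < int L"
      by linarith+
  qed
  have Lc: "int L = 8 * 64 ^ p" "int c = 4 * 64 ^ p"
    by (simp_all add: L_def c_def)
  have "independence_set gap_space shift k U (slot_times L c)"
    unfolding independence_set_def
  proof (intro allI impI)
    fix J s
    assume J: "J \<subseteq> slot_times L c \<and> finite J \<and> J \<noteq> {} \<and> s \<in> J \<rightarrow> {1..k}"
    define r where "r t = (let j = nat (int L * t + int c) in if j \<in> J then s j else 1)" for t
    have r: "r t \<in> {1..k}" for t
      using J k by (auto simp: r_def Let_def)
    define y where "y i = (if i div int L \<in> kept_slots
        then z (r (i div int L)) (i mod int L - int c) else 0)" for i
    have y: "y \<in> gap_sequences"
    proof -
      have "\<bar>i\<bar> \<le> 2 * 64 ^ p" if "z (r t) i \<noteq> 0" for t i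
        using z[OF r[of t]] that p64 by fastforce
      then have "(\<lambda>i. if i div (8 * 64 ^ p) \<in> kept_slots
          then z (r (i div (8 * 64 ^ p))) (i mod (8 * 64 ^ p) - 4 * 64 ^ p) else 0) \<in> gap_sequences"
        using z[OF r] by (intro concatenation_in_gap_sequences) blast+
      then show ?thesis
        unfolding y_def[abs_def] Lc .
    qed
    have "(shift ^^ j) y \<in> U (s j)" if j: "j \<in> J" for j
    proof -
      obtain t where t: "t \<in> kept_slots" "int j = int L * t + int c"
        using J j by (auto simp: slot_times_def)
      have sj: "s j \<in> {1..k}" using J j by auto
      have rt: "r t = s j"
        using j unfolding r_def t(2)[symmetric] by simp
      have "(shift ^^ j) y i = x (s j) i" if i: "\<bar>i\<bar> \<le> int (m (s j))" for i
      proof -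
        have ip: "\<bar>i\<bar> \<le> int p"
          using i mp[OF sj] by linarith
        have b: "0 \<le> i + int c" "i + int c < int L"
          using ip pc by linarith+
        have eq: "i + int j = (i + int c) + int L * t"
          using t by simp
        have "(i + int j) div int L = t" "(i + int j) mod int L = i + int c"
          unfolding eq using b by auto
        then show ?thesis
          using z[OF sj] ip t rt by (simp add: funpow_shift y_def)
      qed
      moreover have "(shift ^^ j) y \<in> gap_sequences"
        unfolding funpow_shift by (rule gap_sequences_translate[OF y])
      ultimately show ?thesis
        using xm[OF sj] by blast
    qed
    then have "y \<in> (\<Inter>j\<in>J. {x \<in> topspace gap_space. (shift ^^ j) x \<in> U (s j)})"
      using y by auto
    then show "(\<Inter>j\<in>J. {x \<in> topspace gap_space. (shift ^^ j) x \<in> U (s j)}) \<noteq> {}"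
      by blast
  qed
  moreover have "upper_Banach_density (slot_times L c) > 0"
    by (rule slot_times_density) (simp add: L_def c_def)
  ultimately show "\<exists>F. independence_set gap_space shift k U F \<and> upper_Banach_density F > 0"
    by blast
qed

theorem mainTheorem6:
  shows "\<exists>(X :: (int \<Rightarrow> real) topology) T.
    invertible_tds X T \<and> nontrivial_space X \<and> topological_K X T \<and> (\<exists>!x. minimal_point X T x)"
proof -
  have "nontrivial_space gap_space"
    unfolding nontrivial_space_def topspace_gap_space
    by (rule bexI[OF bexI[OF _ delta_in_gap_sequences] zero_in_gap_sequences])
      (auto dest: fun_cong[of _ _ 0])
  then show ?thesis
    by (intro exI[of _ gap_space] exI[of _ shift] conjI invertible_gap_shift
      topological_K_gap_shift unique_minimal_gap_shift)
qed

end
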